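(* Consider $n$ nodes placed at the integer points $1, \ldots, n$ of the real line. Let each node be connected to its immediate neighbors (at distance $1$) and to $\ell$ long-distance neighbors chosen independently with replacement, where each long-distance neighbor $v$ of node $u$ is chosen with probability $\frac{1/d(u,v)}{\sum_{v' \neq u} 1/d(u,v')}$, with $d(u,v)=|u-v|$, and $\ell \in [1, \lg n]$. After the links are chosen, let each node fail independently with probability $p$. Messages are routed greedily among live nodes, each node forwarding the message to its live neighbor closest to the target. Then the expected delivery time is $O(\log^2 n/(1-p))$.
   Context: $\lg = \log_2$. The delivery time is the number of hops taken to route a message from a source node to a target node.
   Formalization: Since failures can make the target unreachable (infinite delivery time), routing here stops at a node with no live neighbor strictly closer to the target, and the hops made until then are counted, delivered or not; source and target are conditioned to be live. *)

theory Defs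
  imports "HOL-Probability.Probability"
begin

definition node_dist :: "nat \<Rightarrow> nat \<Rightarrow> real" where
  "node_dist u v = \<bar>real u - real v\<bar>"

definition long_link_prob :: "nat \<Rightarrow> nat \<Rightarrow> nat \<Rightarrow> real" where
  "long_link_prob n u v =
     (if v \<in> {1..n} - {u}
      then (1 / node_dist u v) / (\<Sum>v'\<in>{1..n} - {u}. 1 / node_dist u v')
      else 0)"

definition long_link_pmf :: "nat \<Rightarrow> nat \<Rightarrow> nat pmf" where
  "long_link_pmf n u = embed_pmf (long_link_prob n u)"

lemma pmf_long_link_pmf:
  assumes "n \<ge> 2" "u \<in> {1..n}"
  shows "pmf (long_link_pmf n u) v = long_link_prob n u v"
proof -
  define A where "A = {1..n} - {u}"
  have [simp]: "finite A" by (simp add: A_def)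
  have pos: "1 / node_dist u w > 0" if "w \<in> A" for w
    using that by (auto simp: A_def node_dist_def)
  have "(if u = 1 then 2 else 1) \<in> A"
    using assms by (auto simp: A_def)
  then have S: "(\<Sum>w\<in>A. 1 / node_dist u w) > 0"
    using pos by (intro sum_pos) auto
  have nonneg: "0 \<le> long_link_prob n u w" for w
    by (auto simp: long_link_prob_def node_dist_def intro!: divide_nonneg_nonneg mult_nonneg_nonneg sum_nonneg)
  have "(\<integral>\<^sup>+ w. ennreal (long_link_prob n u w) \<partial>count_space UNIV)
      = (\<Sum>w\<in>A. ennreal (long_link_prob n u w))"
    by (rule nn_integral_count_space') (auto simp: long_link_prob_def A_def)
  also have "\<dots> = ennreal (\<Sum>w\<in>A. long_link_prob n u w)"
    using nonneg by (intro sum_ennreal) auto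
  also have "(\<Sum>w\<in>A. long_link_prob n u w)
      = (\<Sum>w\<in>A. (1 / node_dist u w) / (\<Sum>w\<in>A. 1 / node_dist u w))"
    by (intro sum.cong) (auto simp: long_link_prob_def A_def)
  also have "\<dots> = 1"
    using S by (simp only: sum_divide_distrib[symmetric]) simp
  finally show ?thesis
    unfolding long_link_pmf_def using nonneg by (intro pmf_embed_pmf) auto
qed

text \<open>
  An outcome is a pair: the first component maps \<open>(u, i)\<close> to the \<open>i\<close>-th long-distance neighbor
  of \<open>u\<close> (links are outgoing, with repetitions allowed), the second says which nodes have failed.
\<close>

type_synonym network = "(nat \<times> nat \<Rightarrow> nat) \<times> (nat \<Rightarrow> bool)"

definition network_pmf :: "nat \<Rightarrow> nat \<Rightarrow> real \<Rightarrow> network pmf" where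
  "network_pmf n l p =
     pair_pmf (Pi_pmf ({1..n} \<times> {..<l}) 0 (\<lambda>(u, i). long_link_pmf n u))
              (Pi_pmf {1..n} True (\<lambda>_. bernoulli_pmf p))"

definition live :: "nat \<Rightarrow> network \<Rightarrow> nat set" where
  "live n \<omega> = {v \<in> {1..n}. \<not> snd \<omega> v}"

definition neighbors :: "nat \<Rightarrow> nat \<Rightarrow> network \<Rightarrow> nat \<Rightarrow> nat set" where
  "neighbors n l \<omega> u = {v \<in> {1..n}. node_dist u v = 1} \<union> (\<lambda>i. fst \<omega> (u, i)) ` {..<l}"

definition live_neighbors :: "nat \<Rightarrow> nat \<Rightarrow> network \<Rightarrow> nat \<Rightarrow> nat set" where
  "live_neighbors n l \<omega> u = neighbors n l \<omega> u \<inter> live n \<omega>"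

text \<open>
  The rule \<open>pick u\<close> is how node \<open>u\<close> breaks ties between live neighbors equally close to the target
  \<open>t\<close> (one on each side of \<open>t\<close>). With no live neighbor closer to \<open>t\<close> than the current node,
  greedy routing makes no further hop; in particular it stops at \<open>t\<close>.
\<close>

definition greedy_next ::
  "nat \<Rightarrow> nat \<Rightarrow> (nat \<Rightarrow> nat set \<Rightarrow> nat) \<Rightarrow> network \<Rightarrow> nat \<Rightarrow> nat \<Rightarrow> nat option" where
  "greedy_next n l pick \<omega> t u =
     (let N = live_neighbors n l \<omega> u in
      if \<exists>v\<in>N. node_dist v t < node_dist u t
      then Some (pick u {v. is_arg_min (\<lambda>v. node_dist v t) (\<lambda>v. v \<in> N) v})
      else None)"

text \<open>The node holding the message after \<open>k\<close> hops, or \<open>None\<close> if fewer than \<open>k\<close> hops are made.\<close>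

primrec route ::
  "nat \<Rightarrow> nat \<Rightarrow> (nat \<Rightarrow> nat set \<Rightarrow> nat) \<Rightarrow> network \<Rightarrow> nat \<Rightarrow> nat \<Rightarrow> nat \<Rightarrow> nat option" where
  "route n l pick \<omega> s t 0 = Some s"
| "route n l pick \<omega> s t (Suc k) =
     Option.bind (route n l pick \<omega> s t k) (greedy_next n l pick \<omega> t)"

definition delivery_time ::
  "nat \<Rightarrow> nat \<Rightarrow> (nat \<Rightarrow> nat set \<Rightarrow> nat) \<Rightarrow> network \<Rightarrow> nat \<Rightarrow> nat \<Rightarrow> enat" where
  "delivery_time n l pick \<omega> s t = (SUP k\<in>{k. route n l pick \<omega> s t k \<noteq> None}. enat k)"

text \<open>Routing takes place among live nodes, so source and target are conditioned to be live.\<close>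

definition expected_delivery_time ::
  "nat \<Rightarrow> nat \<Rightarrow> real \<Rightarrow> (nat \<Rightarrow> nat set \<Rightarrow> nat) \<Rightarrow> nat \<Rightarrow> nat \<Rightarrow> ennreal" where
  "expected_delivery_time n l p pick s t =
     (\<integral>\<^sup>+ \<omega>. ennreal_of_enat (delivery_time n l pick \<omega> s t)
        \<partial>measure_pmf (cond_pmf (network_pmf n l p) {\<omega>. {s, t} \<subseteq> live n \<omega>}))"

lemma conditioning_event_possible:
  assumes "0 \<le> p" "p < 1" "s \<in> {1..n}" "t \<in> {1..n}"
  shows "set_pmf (network_pmf n l p) \<inter> {\<omega>. {s, t} \<subseteq> live n \<omega>} \<noteq> {}"
proof -
  obtain f where f: "f \<in> set_pmf (Pi_pmf ({1..n} \<times> {..<l}) 0 (\<lambda>(u, i). long_link_pmf n u))"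
    using set_pmf_not_empty by fast
  have "False \<in> set_pmf (bernoulli_pmf p)"
    using assms by (simp add: set_pmf_iff)
  then have "(\<lambda>v. v \<notin> {1..n}) \<in> set_pmf (Pi_pmf {1..n} True (\<lambda>_. bernoulli_pmf p))"
    by (auto simp: set_Pi_pmf PiE_dflt_def)
  with f have "(f, \<lambda>v. v \<notin> {1..n}) \<in> set_pmf (network_pmf n l p)"
    by (simp add: network_pmf_def)
  moreover have "{s, t} \<subseteq> live n (f, \<lambda>v. v \<notin> {1..n})"
    using assms by (auto simp: live_def)
  ultimately show ?thesis by blast
qed

end

theory Submission
  imports Defs
begin

text \<open>
  Condition on the set of failed nodes first. Every hop strictly decreases the distance to \<open>t\<close>,
  so the links of each visited node are independent of the past. If the message is at \<open>u\<close> with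
  \<open>2\<^sup>j \<le> d(u,t) < 2\<^sup>j\<^sup>+\<^sup>1\<close>, each of the \<open>m\<close> live nodes within distance less than \<open>2\<^sup>j\<close> of
  \<open>t\<close> lies at distance at most \<open>3 2\<^sup>j\<close> from \<open>u\<close>, hence a single long link already leaves
  phase \<open>j\<close> with probability at least \<open>m / (3 2\<^sup>j H)\<close>, where \<open>H = O(log n)\<close> bounds the
  normalising sum. Charging \<open>3 2\<^sup>j H / m\<close> to phase \<open>j\<close> gives a potential that pays for each
  hop in expectation.

  Averaging over the failures, \<open>m\<close> is one (for \<open>t\<close> itself) plus a binomial variable, and
  \<open>E[1 / (1 + Bin(k, q))] \<le> 1 / ((k + 1) q)\<close>. There are at least \<open>2\<^sup>j\<close> nodes within distance
  less than \<open>2\<^sup>j\<close> of \<open>t\<close>, so each of the \<open>O(log n)\<close> phases costs \<open>O(H / (1 - p))\<close>.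
\<close>

section \<open>Greedy hops and the nodes a route depends on\<close>

text \<open>With truncated subtraction at least one summand is zero, so distances are natural
  numbers; their strict decrease along a route can then drive an induction.\<close>

lemma node_dist_nat: "node_dist u v = real (u - v + (v - u))"
  by (auto simp: node_dist_def)

lemma node_dist_triangle: "node_dist u w \<le> node_dist u v + node_dist v w"
  by (auto simp: node_dist_def)

text \<open>The finite set \<open>N\<close> contains a node closer than \<open>u\<close>, so the set
  of minimisers handed to \<open>pick\<close> is nonempty and the choice really is a minimiser, at
  least as close to \<open>t\<close> as that node.\<close>

lemma greedy_next_SomeD:
  assumes pick: "\<And>u A. A \<noteq> {} \<Longrightarrow> pick u A \<in> A"
    and next_v: "greedy_next n l pick \<omega> t u = Some v"
  shows "v \<in> {1..n}" "node_dist v t < node_dist u t"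
    and "\<And>w. w \<in> live_neighbors n l \<omega> u \<Longrightarrow> node_dist v t \<le> node_dist w t"
proof -
  define N where "N = live_neighbors n l \<omega> u"
  have "finite N" by (simp add: N_def live_neighbors_def live_def)
  obtain x where x: "x \<in> N" "node_dist x t < node_dist u t"
    using next_v by (auto simp: greedy_next_def N_def Let_def split: if_splits)
  have "is_arg_min (\<lambda>v. node_dist v t) (\<lambda>v. v \<in> N) (arg_min_on (\<lambda>v. node_dist v t) N)"
    using x \<open>finite N\<close> by (auto simp: is_arg_min_linorder intro: arg_min_least arg_min_if_finite(1))
  then have "pick u {v. is_arg_min (\<lambda>v. node_dist v t) (\<lambda>v. v \<in> N) v}
      \<in> {v. is_arg_min (\<lambda>v. node_dist v t) (\<lambda>v. v \<in> N) v}"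
    by (intro pick) blast
  moreover have "pick u {v. is_arg_min (\<lambda>v. node_dist v t) (\<lambda>v. v \<in> N) v} = v"
    using next_v by (auto simp: greedy_next_def N_def Let_def split: if_splits)
  ultimately have "is_arg_min (\<lambda>v. node_dist v t) (\<lambda>v. v \<in> N) v"
    by (metis mem_Collect_eq)
  then have v: "v \<in> N" "\<And>w. w \<in> N \<Longrightarrow> node_dist v t \<le> node_dist w t"
    by (auto simp: is_arg_min_linorder)
  show "v \<in> {1..n}" using v(1) by (auto simp: N_def live_neighbors_def live_def)
  show "node_dist v t < node_dist u t" using v(2)[OF x(1)] x(2) by simp
  show "node_dist v t \<le> node_dist w t" if "w \<in> live_neighbors n l \<omega> u" for w
    using v(2) that by (simp add: N_def)
qed

lemma greedy_next_cong:
  assumes "\<And>i. i < l \<Longrightarrow> f (u, i) = g (u, i)"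
  shows "greedy_next n l pick (f, F) t u = greedy_next n l pick (g, F) t u"
proof -
  have "(\<lambda>i. f (u, i)) ` {..<l} = (\<lambda>i. g (u, i)) ` {..<l}"
    using assms by (intro image_cong) auto
  then have "live_neighbors n l (f, F) u = live_neighbors n l (g, F) u"
    by (simp add: live_neighbors_def neighbors_def live_def)
  then show ?thesis by (simp add: greedy_next_def)
qed

text \<open>\<open>route\<close> appends hops at the end, while the recursion for the expectation
  splits off the first hop.\<close>

lemma route_Suc_first:
  "route n l pick \<omega> s t (Suc k) =
     Option.bind (greedy_next n l pick \<omega> t s) (\<lambda>v. route n l pick \<omega> v t k)"
proof (induction k)
  case (Suc k)
  then show ?case
    by (subst route.simps(2), subst Suc) (auto split: Option.bind_split)
qed simp

lemma route_node_dist_le: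
  assumes pick: "\<And>u A. A \<noteq> {} \<Longrightarrow> pick u A \<in> A"
  shows "route n l pick \<omega> s t k = Some v \<Longrightarrow> node_dist v t \<le> node_dist s t"
proof (induction k arbitrary: v)
  case (Suc k)
  then obtain w where "route n l pick \<omega> s t k = Some w" "greedy_next n l pick \<omega> t w = Some v"
    by (auto split: Option.bind_splits)
  then show ?case
    using Suc.IH greedy_next_SomeD(2)[OF pick] by fastforce
qed simp

text \<open>A route from \<open>s\<close> never moves away from \<open>t\<close>, so it consults
  only links of nodes at most as far from \<open>t\<close> as \<open>s\<close>. This locality is the
  source of the independence used below.\<close>

lemma route_cong:
  assumes pick: "\<And>u A. A \<noteq> {} \<Longrightarrow> pick u A \<in> A"
    and agree: "\<And>w i. node_dist w t \<le> node_dist s t \<Longrightarrow> i < l \<Longrightarrow> f (w, i) = g (w, i)"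
  shows "route n l pick (f, F) s t k = route n l pick (g, F) s t k"
proof (induction k)
  case (Suc k)
  show ?case
  proof (cases "route n l pick (g, F) s t k")
    case None
    then show ?thesis using Suc by simp
  next
    case (Some w)
    have "greedy_next n l pick (f, F) t w = greedy_next n l pick (g, F) t w"
      using agree route_node_dist_le[OF pick Some] by (intro greedy_next_cong) auto
    then show ?thesis using Suc Some by simp
  qed
qed simp

lemma delivery_time_cong:
  assumes "\<And>u A. A \<noteq> {} \<Longrightarrow> pick u A \<in> A"
    and "\<And>w i. node_dist w t \<le> node_dist s t \<Longrightarrow> i < l \<Longrightarrow> f (w, i) = g (w, i)"
  shows "delivery_time n l pick (f, F) s t = delivery_time n l pick (g, F) s t"
proof -
  have "route n l pick (f, F) s t = route n l pick (g, F) s t"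
    by (intro ext route_cong) (use assms in auto)
  then show ?thesis by (simp add: delivery_time_def)
qed

text \<open>A route of \<open>m + 1\<close> hops is a first hop followed by a route of
  \<open>m\<close> hops from its endpoint; without a first hop only \<open>k = 0\<close>
  remains.\<close>

lemma delivery_time_le_first_hop:
  "delivery_time n l pick \<omega> s t \<le>
     (case greedy_next n l pick \<omega> t s of None \<Rightarrow> 0 | Some v \<Rightarrow> eSuc (delivery_time n l pick \<omega> v t))"
  unfolding delivery_time_def[of n l pick \<omega> s]
proof (rule SUP_least)
  fix k assume k: "k \<in> {k. route n l pick \<omega> s t k \<noteq> None}"
  show "enat k \<le> (case greedy_next n l pick \<omega> t s of None \<Rightarrow> 0 | Some v \<Rightarrow> eSuc (delivery_time n l pick \<omega> v t))"
  proof (cases k)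
    case 0
    then show ?thesis by (simp add: zero_enat_def[symmetric])
  next
    case (Suc m)
    then obtain v where v: "greedy_next n l pick \<omega> t s = Some v" "route n l pick \<omega> v t m \<noteq> None"
      using k by (auto simp del: route.simps(2) simp: route_Suc_first bind_eq_Some_conv)
    then have "enat m \<le> delivery_time n l pick \<omega> v t"
      unfolding delivery_time_def by (intro SUP_upper) auto
    then show ?thesis using v Suc by (simp add: eSuc_enat[symmetric])
  qed
qed

section \<open>The normalising sum of the link distribution\<close>

text \<open>On each side of \<open>u\<close> the distances are distinct numbers in
  \<open>{1..n}\<close>, so each side contributes at most a harmonic number.\<close>

lemma sum_inverse_node_dist_le:
  assumes "u \<in> {1..n}"
  shows "(\<Sum>v\<in>{1..n} - {u}. 1 / node_dist u v) \<le> 2 * (1 + ln (real n))"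
proof -
  have harm: "(\<Sum>v\<in>A. 1 / node_dist u v) \<le> harm n"
    if "inj_on h A" "h ` A \<subseteq> {1..n}" "\<And>v. v \<in> A \<Longrightarrow> node_dist u v = real (h v)"
    for h :: "nat \<Rightarrow> nat" and A
  proof -
    have "(\<Sum>v\<in>A. 1 / node_dist u v) = (\<Sum>k\<in>h ` A. 1 / real k)"
      using that by (simp add: sum.reindex)
    also have "\<dots> \<le> (\<Sum>k\<in>{1..n}. 1 / real k)"
      using that by (intro sum_mono2) auto
    finally show ?thesis by (simp add: harm_def divide_inverse)
  qed
  have split: "{1..n} - {u} = {1..<u} \<union> {u<..n}" using assms by auto
  have "(\<Sum>v\<in>{1..n} - {u}. 1 / node_dist u v)
      = (\<Sum>v\<in>{1..<u}. 1 / node_dist u v) + (\<Sum>v\<in>{u<..n}. 1 / node_dist u v)"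
    unfolding split by (rule sum.union_disjoint) auto
  also have "\<dots> \<le> harm n + harm n"
  proof (rule add_mono)
    show "(\<Sum>v\<in>{1..<u}. 1 / node_dist u v) \<le> harm n"
      by (rule harm[of "\<lambda>v. u - v"]) (use assms in \<open>auto simp: inj_on_def node_dist_nat\<close>)
    show "(\<Sum>v\<in>{u<..n}. 1 / node_dist u v) \<le> harm n"
      by (rule harm[of "\<lambda>v. v - u"]) (use assms in \<open>auto simp: inj_on_def node_dist_nat\<close>)
  qed
  \<comment> \<open>\<open>harm n - ln n\<close> decreases in \<open>n\<close> and equals 1 at
    \<open>n = 1\<close>. The library sequence is shifted by one, hence the indices 0 and
    \<open>n - 1\<close>.\<close>
  also have "\<dots> \<le> 2 * (1 + ln (real n))"
    using decseqD[OF decseq_harm_diff_ln, of 0 "n - 1"] assms by (cases n) (auto simp: harm_expand)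
  finally show ?thesis .
qed

section \<open>Distance phases and the potential\<close>

text \<open>The inequality is strict so that a node in the ball has already left phase
  \<open>j\<close>, the distances from \<open>2 ^ j\<close> up to but excluding
  \<open>2 ^ Suc j\<close>.\<close>

definition phase_ball :: "nat \<Rightarrow> nat \<Rightarrow> nat \<Rightarrow> nat set" where
  "phase_ball n t j = {v \<in> {1..n}. node_dist v t < 2 ^ j}"

text \<open>The reciprocal of a lower bound for the chance that one long link hits a live node of
  the ball. An empty count would give 0, but a live \<open>t\<close> in \<open>{1..n}\<close> always
  lies in its ball.\<close>

definition phase_cost :: "nat \<Rightarrow> nat \<Rightarrow> real \<Rightarrow> (nat \<Rightarrow> bool) \<Rightarrow> nat \<Rightarrow> real" where
  "phase_cost n t H F j = 3 * 2 ^ j * H / real (card {v \<in> phase_ball n t j. \<not> F v})"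

text \<open>Sums the phases that a message at distance \<open>d\<close> has yet to leave, the
  current one included; at the target itself the sum is empty.\<close>

definition potential :: "nat \<Rightarrow> nat \<Rightarrow> real \<Rightarrow> (nat \<Rightarrow> bool) \<Rightarrow> real \<Rightarrow> real" where
  "potential n t H F d = (\<Sum>j | 2 ^ j \<le> d. phase_cost n t H F j)"

lemma finite_phase_ball [simp]: "finite (phase_ball n t j)"
  by (simp add: phase_ball_def)

lemma finite_phases: "finite {j::nat. 2 ^ j \<le> (d::real)}"
proof (rule finite_subset)
  show "{j::nat. 2 ^ j \<le> d} \<subseteq> {..nat \<lceil>d\<rceil>}"
  proof safe
    fix j :: nat assume "2 ^ j \<le> d"
    moreover have "real j < 2 ^ j" by (rule of_nat_less_two_power)
    ultimately show "j \<le> nat \<lceil>d\<rceil>" by linarith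
  qed
qed simp

lemma phase_cost_nonneg: "0 \<le> H \<Longrightarrow> 0 \<le> phase_cost n t H F j"
  by (simp add: phase_cost_def)

lemma potential_nonneg: "0 \<le> H \<Longrightarrow> 0 \<le> potential n t H F d"
  by (simp add: potential_def sum_nonneg phase_cost_nonneg)

lemma potential_mono: "0 \<le> H \<Longrightarrow> d \<le> d' \<Longrightarrow> potential n t H F d \<le> potential n t H F d'"
  unfolding potential_def
  by (intro sum_mono2 finite_phases) (auto intro: phase_cost_nonneg)

text \<open>Phase \<open>j\<close> is charged at \<open>d'\<close> but no longer at
  \<open>d\<close>; every phase charged at \<open>d\<close> is also charged at \<open>d'\<close>,
  and all costs are nonnegative.\<close>

lemma potential_drop:
  assumes "0 \<le> H" "d < 2 ^ j" "2 ^ j \<le> d'"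
  shows "potential n t H F d + phase_cost n t H F j \<le> potential n t H F d'"
proof -
  have "potential n t H F d + phase_cost n t H F j
      = (\<Sum>i\<in>insert j {i. 2 ^ i \<le> d}. phase_cost n t H F i)"
    using assms by (simp add: potential_def finite_phases)
  also have "\<dots> \<le> potential n t H F d'"
    unfolding potential_def using assms
    by (intro sum_mono2 finite_phases) (auto intro: phase_cost_nonneg)
  finally show ?thesis .
qed

lemma ex_phase:
  assumes "1 \<le> (d::real)"
  shows "\<exists>j::nat. 2 ^ j \<le> d \<and> d < 2 ^ Suc j"
proof -
  define j where "j = Max {j::nat. 2 ^ j \<le> d}"
  have "0 \<in> {j::nat. 2 ^ j \<le> d}" using assms by simp
  then have "j \<in> {j. 2 ^ j \<le> d}"
    unfolding j_def by (intro Max_in finite_phases) blast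
  moreover have "Suc j \<notin> {j. 2 ^ j \<le> d}"
    unfolding j_def using Max_ge[OF finite_phases] Suc_n_not_le_n by blast
  ultimately show ?thesis by auto
qed

section \<open>Leaving a phase by one long link\<close>

lemma phase_cost_long_link:
  assumes "n \<ge> 2" "u \<in> {1..n}" "t \<in> {1..n}" "\<not> F t"
    and H: "(\<Sum>v\<in>{1..n} - {u}. 1 / node_dist u v) \<le> H"
    and j: "2 ^ j \<le> node_dist u t" "node_dist u t < 2 ^ Suc j"
  shows "1 \<le> phase_cost n t H F j
    * measure (measure_pmf (long_link_pmf n u)) {v \<in> phase_ball n t j. \<not> F v}"
proof -
  define X where "X = {v \<in> phase_ball n t j. \<not> F v}"
  define S where "S = (\<Sum>v\<in>{1..n} - {u}. 1 / node_dist u v)"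
  have [simp]: "finite X" by (simp add: X_def)
  have "t \<in> X" using assms by (auto simp: X_def phase_ball_def node_dist_def)
  then have X: "0 < card X" by (auto simp: card_gt_0_iff)
  \<comment> \<open>Some node other than \<open>u\<close> exists since \<open>n \<ge> 2\<close>;
    this makes the normalising sum, and with it \<open>H\<close>, positive.\<close>
  have "(if u = 1 then 2 else 1) \<in> {1..n} - {u}"
    using assms by auto
  then have S: "0 < S"
    unfolding S_def by (intro sum_pos) (auto simp: node_dist_def)
  with H have "0 < H" by (simp add: S_def)
  have link: "1 / (3 * 2 ^ j * H) \<le> pmf (long_link_pmf n u) v" if "v \<in> X" for v
  proof -
    have v: "v \<in> {1..n}" "node_dist v t < 2 ^ j" using that by (auto simp: X_def phase_ball_def)
    then have "v \<noteq> u" using j by auto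
    have "node_dist u v \<le> node_dist u t + node_dist v t"
      using node_dist_triangle[of u v t] by (simp add: node_dist_def)
    \<comment> \<open>The 3 adds up \<open>node_dist u t < 2 * 2 ^ j\<close> and
      \<open>node_dist v t < 2 ^ j\<close>.\<close>
    also have "\<dots> \<le> 3 * 2 ^ j" using v j by simp
    finally have "node_dist u v \<le> 3 * 2 ^ j" .
    moreover have "0 < node_dist u v" using \<open>v \<noteq> u\<close> by (simp add: node_dist_def)
    ultimately have "1 / (3 * 2 ^ j * H) \<le> 1 / (node_dist u v * S)"
      using H S by (intro divide_left_mono mult_mono mult_pos_pos) (auto simp: S_def)
    also have "\<dots> = pmf (long_link_pmf n u) v"
      using assms v \<open>v \<noteq> u\<close> by (simp add: pmf_long_link_pmf long_link_prob_def S_def)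
    finally show ?thesis .
  qed
  have "1 = phase_cost n t H F j * (\<Sum>v\<in>X. 1 / (3 * 2 ^ j * H))"
    using X \<open>0 < H\<close> by (simp add: phase_cost_def X_def[symmetric] card_gt_0_iff)
  also have "\<dots> \<le> phase_cost n t H F j * (\<Sum>v\<in>X. pmf (long_link_pmf n u) v)"
    using \<open>0 < H\<close> by (intro mult_left_mono sum_mono link phase_cost_nonneg) auto
  finally show ?thesis by (simp add: X_def[symmetric] measure_measure_pmf_finite)
qed

section \<open>Expected number of hops for fixed failures\<close>

text \<open>The restrictions of a product sample to \<open>A\<close> and to \<open>I - A\<close> are
  independent, so the second argument may be drawn afresh. Applied to the links of one node against
  all others, and to the failures of \<open>s\<close> and \<open>t\<close> against the rest.\<close>

lemma nn_integral_Pi_pmf_indep: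
  fixes h :: "('a \<Rightarrow> 'b) \<Rightarrow> ('a \<Rightarrow> 'b) \<Rightarrow> ennreal"
  assumes fin: "finite I" and "A \<subseteq> I"
    and h: "\<And>f f' g g'. (\<And>x. x \<in> A \<Longrightarrow> f x = f' x) \<Longrightarrow> (\<And>x. x \<notin> A \<Longrightarrow> g x = g' x) \<Longrightarrow> h f g = h f' g'"
  shows "(\<integral>\<^sup>+ f. h f f \<partial>Pi_pmf I d p) = (\<integral>\<^sup>+ f. \<integral>\<^sup>+ g. h f g \<partial>Pi_pmf I d p \<partial>Pi_pmf I d p)"
proof -
  define m where "m = (\<lambda>(a, b) x. if x \<in> A then a x else (b x :: 'b))"
  define PA where "PA = Pi_pmf A d p"
  define PB where "PB = Pi_pmf (I - A) d p"
  have "Pi_pmf (A \<union> (I - A)) d p = map_pmf m (pair_pmf PA PB)"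
    unfolding m_def PA_def PB_def
    by (rule Pi_pmf_union) (use assms finite_subset in auto)
  moreover have "A \<union> (I - A) = I" using \<open>A \<subseteq> I\<close> by auto
  ultimately have PI: "Pi_pmf I d p = map_pmf m (pair_pmf PA PB)" by simp
  \<comment> \<open>With one sample or with two, the integrand reduces to a function of an
    \<open>A\<close> part and an outside part; the leftover parts integrate to 1.\<close>
  have hm: "h (m (a, b)) (m (a', b')) = h a b'" for a b a' b'
    by (rule h) (auto simp: m_def)
  show ?thesis
    by (simp add: PI nn_integral_pair_pmf' hm measure_pmf.emeasure_space_1)
qed

definition links_pmf :: "nat \<Rightarrow> nat \<Rightarrow> (nat \<times> nat \<Rightarrow> nat) pmf" where
  "links_pmf n l = Pi_pmf ({1..n} \<times> {..<l}) 0 (\<lambda>(u, i). long_link_pmf n u)"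

text \<open>
  Later hops only visit nodes closer to the target than \<open>u\<close>, so their links are independent of
  those of \<open>u\<close>.
\<close>

lemma nn_integral_delivery_time_le:
  assumes pick: "\<And>u A. A \<noteq> {} \<Longrightarrow> pick u A \<in> A" and u: "u \<in> {1..n}"
  shows "(\<integral>\<^sup>+ f. ennreal_of_enat (delivery_time n l pick (f, F) u t) \<partial>links_pmf n l) \<le>
    (\<integral>\<^sup>+ f. (case greedy_next n l pick (f, F) t u of None \<Rightarrow> 0
       | Some v \<Rightarrow> 1 + (\<integral>\<^sup>+ g. ennreal_of_enat (delivery_time n l pick (g, F) v t) \<partial>links_pmf n l))
     \<partial>links_pmf n l)"
proof -
  \<comment> \<open>The arguments separate two roles: \<open>f\<close> determines the hop out of
    \<open>u\<close>, \<open>g\<close> everything after it. The diagonal \<open>h f f\<close> bounds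
    the actual delivery time.\<close>
  define h where "h f g = (case greedy_next n l pick (f, F) t u of None \<Rightarrow> 0
       | Some v \<Rightarrow> 1 + ennreal_of_enat (delivery_time n l pick (g, F) v t))" for f g
  have h_cong: "h f g = h f' g'"
    if ff': "\<And>x. x \<in> {u} \<times> {..<l} \<Longrightarrow> f x = f' x" and gg': "\<And>x. x \<notin> {u} \<times> {..<l} \<Longrightarrow> g x = g' x"
    for f f' g g'
  proof -
    have eq: "greedy_next n l pick (f, F) t u = greedy_next n l pick (f', F) t u"
      using ff' by (intro greedy_next_cong) auto
    show ?thesis
    proof (cases "greedy_next n l pick (f', F) t u")
      case (Some v)
      have "delivery_time n l pick (g, F) v t = delivery_time n l pick (g', F) v t"
        using greedy_next_SomeD(2)[OF pick Some] by (intro delivery_time_cong pick gg') auto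
      then show ?thesis by (simp add: h_def eq Some)
    qed (simp add: h_def eq)
  qed
  have "ennreal_of_enat (delivery_time n l pick (f, F) u t) \<le> h f f" for f
  proof -
    have "ennreal_of_enat (delivery_time n l pick (f, F) u t) \<le> ennreal_of_enat
      (case greedy_next n l pick (f, F) t u of None \<Rightarrow> 0 | Some v \<Rightarrow> eSuc (delivery_time n l pick (f, F) v t))"
      by (simp only: ennreal_of_enat_le_iff delivery_time_le_first_hop)
    also have "\<dots> = h f f" by (simp add: h_def split: option.split)
    finally show ?thesis .
  qed
  then have "(\<integral>\<^sup>+ f. ennreal_of_enat (delivery_time n l pick (f, F) u t) \<partial>links_pmf n l)
      \<le> (\<integral>\<^sup>+ f. h f f \<partial>links_pmf n l)"
    by (intro nn_integral_mono) auto
  also have "\<dots> = (\<integral>\<^sup>+ f. \<integral>\<^sup>+ g. h f g \<partial>links_pmf n l \<partial>links_pmf n l)"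
    unfolding links_pmf_def
    by (rule nn_integral_Pi_pmf_indep[where A = "{u} \<times> {..<l}", OF _ _ h_cong]) (use u in auto)
  also have "\<dots> = (\<integral>\<^sup>+ f. (case greedy_next n l pick (f, F) t u of None \<Rightarrow> 0
       | Some v \<Rightarrow> 1 + (\<integral>\<^sup>+ g. ennreal_of_enat (delivery_time n l pick (g, F) v t) \<partial>links_pmf n l))
     \<partial>links_pmf n l)"
    by (intro nn_integral_cong)
       (simp add: h_def nn_integral_add measure_pmf.emeasure_space_1 split: option.split)
  finally show ?thesis .
qed

text \<open>A drift inequality. No hop raises the potential, and it falls by at least the phase cost
  \<open>c\<close> when long link 0 hits a live node of the ball. This has probability at least
  \<open>1 / c\<close>, so the expected drop pays for the hop.\<close>

lemma nn_integral_potential_le: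
  assumes pick: "\<And>u A. A \<noteq> {} \<Longrightarrow> pick u A \<in> A" and "n \<ge> 2" "l \<ge> 1"
    and u: "u \<in> {1..n}" and t: "t \<in> {1..n}" "\<not> F t"
    and H: "(\<Sum>v\<in>{1..n} - {u}. 1 / node_dist u v) \<le> H"
  shows "(\<integral>\<^sup>+ f. (case greedy_next n l pick (f, F) t u of None \<Rightarrow> 0
       | Some v \<Rightarrow> 1 + ennreal (potential n t H F (node_dist v t))) \<partial>links_pmf n l)
     \<le> ennreal (potential n t H F (node_dist u t))"
    (is "(\<integral>\<^sup>+ f. ?g f \<partial>_) \<le> _")
proof (cases "u = t")
  case True
  then have "greedy_next n l pick (f, F) t u = None" for f
    by (simp add: greedy_next_def node_dist_def Let_def)
  then show ?thesis by simp
next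
  case False
  have "0 \<le> (\<Sum>v\<in>{1..n} - {u}. 1 / node_dist u v)"
    by (intro sum_nonneg) (simp add: node_dist_def)
  then have "0 \<le> H" using H by simp
  have "1 \<le> node_dist u t" using False by (simp add: node_dist_nat)
  then obtain j where j: "2 ^ j \<le> node_dist u t" "node_dist u t < 2 ^ Suc j"
    using ex_phase by blast
  define X where "X = {v \<in> phase_ball n t j. \<not> F v}"
  define c where "c = phase_cost n t H F j"
  define \<Phi> where "\<Phi> = (\<lambda>d. potential n t H F d)"
  have "0 \<le> c" using \<open>0 \<le> H\<close> by (simp add: c_def phase_cost_nonneg)
  have \<Phi>_nonneg: "0 \<le> \<Phi> d" for d using \<open>0 \<le> H\<close> by (simp add: \<Phi>_def potential_nonneg)
  \<comment> \<open>The drop \<open>c\<close> is added on the left because subtraction in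
    \<open>ennreal\<close> truncates at 0.\<close>
  have hop: "?g f + ennreal c * indicator {f. f (u, 0) \<in> X} f \<le> 1 + ennreal (\<Phi> (node_dist u t))" for f
  proof (cases "f (u, 0) \<in> X")
    case True
    have near: "node_dist (f (u, 0)) t < 2 ^ j" using True by (simp add: X_def phase_ball_def)
    have nbr: "f (u, 0) \<in> live_neighbors n l (f, F) u"
      using True \<open>l \<ge> 1\<close> by (auto simp: X_def phase_ball_def live_neighbors_def neighbors_def live_def)
    have "\<exists>v\<in>live_neighbors n l (f, F) u. node_dist v t < node_dist u t"
      using nbr near j by (intro bexI[of _ "f (u, 0)"]) auto
    then obtain v where v: "greedy_next n l pick (f, F) t u = Some v"
      by (auto simp: greedy_next_def Let_def)
    \<comment> \<open>The greedy choice is at least as close to \<open>t\<close> as the end of link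
      0, so it leaves the phase too.\<close>
    have "node_dist v t < 2 ^ j"
      using greedy_next_SomeD(3)[OF pick v nbr] near by simp
    then have "\<Phi> (node_dist v t) + c \<le> \<Phi> (node_dist u t)"
      unfolding \<Phi>_def c_def using j \<open>0 \<le> H\<close> by (intro potential_drop)
    then have "ennreal (\<Phi> (node_dist v t)) + ennreal c \<le> ennreal (\<Phi> (node_dist u t))"
      using \<open>0 \<le> c\<close> \<Phi>_nonneg by (simp flip: ennreal_plus)
    then show ?thesis using v True by (simp add: add.assoc \<Phi>_def)
  next
    case False
    show ?thesis
    proof (cases "greedy_next n l pick (f, F) t u")
      case (Some v)
      have "\<Phi> (node_dist v t) \<le> \<Phi> (node_dist u t)"
        unfolding \<Phi>_def using greedy_next_SomeD(2)[OF pick Some] \<open>0 \<le> H\<close>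
        by (intro potential_mono) auto
      then show ?thesis using False Some by (simp add: \<Phi>_def ennreal_leI)
    qed (use False in simp)
  qed
  have "map_pmf (\<lambda>f. f (u, 0)) (links_pmf n l) = long_link_pmf n u"
    unfolding links_pmf_def using u \<open>l \<ge> 1\<close> by (subst Pi_pmf_component) auto
  then have "emeasure (links_pmf n l) {f. f (u, 0) \<in> X} = emeasure (long_link_pmf n u) X"
    by (metis emeasure_map_pmf vimage_def)
  moreover have "1 \<le> c * measure (long_link_pmf n u) X"
    unfolding c_def X_def using assms j by (intro phase_cost_long_link)
  ultimately have "1 \<le> ennreal c * emeasure (links_pmf n l) {f. f (u, 0) \<in> X}"
    using \<open>0 \<le> c\<close> by (simp add: measure_pmf.emeasure_eq_measure flip: ennreal_mult ennreal_1)
  \<comment> \<open>The 1 on the left is dominated by the expected drop; the 1 emerging on the right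
    pays for the hop. Being finite, they cancel at the end.\<close>
  then have "(\<integral>\<^sup>+ f. ?g f \<partial>links_pmf n l) + 1
      \<le> (\<integral>\<^sup>+ f. ?g f \<partial>links_pmf n l) + (\<integral>\<^sup>+ f. ennreal c * indicator {f. f (u, 0) \<in> X} f \<partial>links_pmf n l)"
    by (intro add_left_mono) (simp add: nn_integral_cmult)
  also have "\<dots> = (\<integral>\<^sup>+ f. ?g f + ennreal c * indicator {f. f (u, 0) \<in> X} f \<partial>links_pmf n l)"
    by (rule nn_integral_add[symmetric]) auto
  also have "\<dots> \<le> (\<integral>\<^sup>+ f. 1 + ennreal (\<Phi> (node_dist u t)) \<partial>links_pmf n l)"
    by (intro nn_integral_mono hop)
  also have "\<dots> = ennreal (\<Phi> (node_dist u t)) + 1"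
    by (simp add: measure_pmf.emeasure_space_1 add.commute)
  finally show ?thesis
    by (simp add: \<Phi>_def add.commute[of _ 1] ennreal_add_left_cancel_le)
qed

text \<open>Induction on the distance to \<open>t\<close>: the first-hop recursion, the induction
  hypothesis at every possible next node, then the drift inequality.\<close>

lemma nn_integral_delivery_time_le_potential:
  assumes pick: "\<And>u A. A \<noteq> {} \<Longrightarrow> pick u A \<in> A" and "n \<ge> 2" "l \<ge> 1"
    and t: "t \<in> {1..n}" "\<not> F t"
    and H: "\<And>u. u \<in> {1..n} \<Longrightarrow> (\<Sum>v\<in>{1..n} - {u}. 1 / node_dist u v) \<le> H"
  shows "u \<in> {1..n} \<Longrightarrow>
    (\<integral>\<^sup>+ f. ennreal_of_enat (delivery_time n l pick (f, F) u t) \<partial>links_pmf n l)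
      \<le> ennreal (potential n t H F (node_dist u t))"
proof (induction "u - t + (t - u)" arbitrary: u rule: less_induct)
  case less
  have IH: "(\<integral>\<^sup>+ g. ennreal_of_enat (delivery_time n l pick (g, F) v t) \<partial>links_pmf n l)
      \<le> ennreal (potential n t H F (node_dist v t))"
    if "greedy_next n l pick (f, F) t u = Some v" for f v
    using greedy_next_SomeD(1,2)[OF pick that]
    by (intro less.hyps) (auto simp only: node_dist_nat of_nat_less_iff)
  have "(\<integral>\<^sup>+ f. ennreal_of_enat (delivery_time n l pick (f, F) u t) \<partial>links_pmf n l) \<le>
    (\<integral>\<^sup>+ f. (case greedy_next n l pick (f, F) t u of None \<Rightarrow> 0
       | Some v \<Rightarrow> 1 + (\<integral>\<^sup>+ g. ennreal_of_enat (delivery_time n l pick (g, F) v t) \<partial>links_pmf n l))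
     \<partial>links_pmf n l)"
    by (rule nn_integral_delivery_time_le[OF pick less.prems])
  also have "\<dots> \<le> (\<integral>\<^sup>+ f. (case greedy_next n l pick (f, F) t u of None \<Rightarrow> 0
       | Some v \<Rightarrow> 1 + ennreal (potential n t H F (node_dist v t))) \<partial>links_pmf n l)"
    by (intro nn_integral_mono) (auto split: option.split intro!: add_left_mono IH)
  also have "\<dots> \<le> ennreal (potential n t H F (node_dist u t))"
    using assms less.prems by (intro nn_integral_potential_le)
  finally show ?case .
qed

section \<open>Averaging over the failures\<close>

text \<open>By \<open>(k + 1) * (Suc m choose Suc k) = (m + 1) * (m choose k)\<close>, the sum times
  \<open>(m + 1) * q\<close> is the expansion of \<open>(q + (1 - q)) ^ Suc m\<close> without its
  first term, hence at most 1.\<close>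

lemma nn_integral_binomial_pmf_inverse_Suc_le:
  assumes q: "0 < q" "q \<le> 1"
  shows "(\<integral>\<^sup>+ k. ennreal (1 / (1 + real k)) \<partial>binomial_pmf m q) \<le> ennreal (1 / ((1 + real m) * q))"
proof -
  have term_eq: "1 / (1 + real k) * (real (m choose k) * q ^ k * (1 - q) ^ (m - k)) * ((1 + real m) * q)
      = real (Suc m choose Suc k) * q ^ Suc k * (1 - q) ^ (Suc m - Suc k)" for k
  proof -
    have "real (Suc k) * real (Suc m choose Suc k) = real (Suc m) * real (m choose k)"
      by (metis Suc_times_binomial_eq mult.commute of_nat_mult)
    then have "real (Suc m choose Suc k) = (1 + real m) * real (m choose k) / (1 + real k)"
      by (simp add: eq_divide_eq mult.commute del: binomial_Suc_Suc)
    then show ?thesis by (simp add: mult_ac del: binomial_Suc_Suc)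
  qed
  have "(\<Sum>k\<le>m. 1 / (1 + real k) * pmf (binomial_pmf m q) k) * ((1 + real m) * q)
      = (\<Sum>k\<le>m. real (Suc m choose Suc k) * q ^ Suc k * (1 - q) ^ (Suc m - Suc k))"
    unfolding sum_distrib_right using q
    by (intro sum.cong refl) (simp only: pmf_binomial[OF less_imp_le] term_eq)
  also have "\<dots> \<le> (\<Sum>k\<le>Suc m. real (Suc m choose k) * q ^ k * (1 - q) ^ (Suc m - k))"
    using q by (subst sum.atMost_Suc_shift) (simp del: binomial_Suc_Suc)
  also have "\<dots> = (q + (1 - q)) ^ Suc m"
    by (rule binomial_ring[symmetric])
  finally have "(\<Sum>k\<le>m. 1 / (1 + real k) * pmf (binomial_pmf m q) k) \<le> 1 / ((1 + real m) * q)"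
    using q by (simp add: pos_le_divide_eq)
  moreover have "set_pmf (binomial_pmf m q) \<subseteq> {..m}"
    using q by (auto simp: set_pmf_binomial_eq)
  then have "(\<integral>\<^sup>+ k. ennreal (1 / (1 + real k)) \<partial>binomial_pmf m q)
      = (\<Sum>k\<le>m. ennreal (1 / (1 + real k)) * ennreal (pmf (binomial_pmf m q) k))"
    by (intro nn_integral_measure_pmf_support) auto
  then have "(\<integral>\<^sup>+ k. ennreal (1 / (1 + real k)) \<partial>binomial_pmf m q)
      = ennreal (\<Sum>k\<le>m. 1 / (1 + real k) * pmf (binomial_pmf m q) k)"
    by (subst sum_ennreal[symmetric]) (auto simp only: ennreal_mult pmf_nonneg divide_nonneg_nonneg
        zero_le_one add_nonneg_nonneg of_nat_0_le_iff mult_nonneg_nonneg)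
  ultimately show ?thesis by (simp add: ennreal_leI)
qed

lemma map_pmf_Not_bernoulli:
  assumes "0 \<le> p" "p \<le> 1"
  shows "map_pmf Not (bernoulli_pmf p) = bernoulli_pmf (1 - p)"
proof (rule pmf_eqI)
  fix b
  have "pmf (map_pmf Not (bernoulli_pmf p)) (\<not> \<not> b) = pmf (bernoulli_pmf p) (\<not> b)"
    by (rule pmf_map_inj') (simp add: inj_def)
  then show "pmf (map_pmf Not (bernoulli_pmf p)) b = pmf (bernoulli_pmf (1 - p)) b"
    using assms by (cases b) simp_all
qed

lemma map_pmf_card_live:
  assumes "finite A" "B \<subseteq> A" "0 \<le> p" "p \<le> 1"
  shows "map_pmf (\<lambda>F. card {v \<in> B. \<not> F v}) (Pi_pmf A True (\<lambda>_. bernoulli_pmf p))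
    = binomial_pmf (card B) (1 - p)"
proof -
  have "finite B" using assms finite_subset by blast
  then have "binomial_pmf (card B) (1 - p)
      = map_pmf (\<lambda>f. card {v \<in> B. f v}) (Pi_pmf B False (\<lambda>_. map_pmf Not (bernoulli_pmf p)))"
    using assms by (simp add: binomial_pmf_altdef'[where dflt = False] map_pmf_Not_bernoulli)
  \<comment> \<open>\<open>Not\<close> can be pulled out of the product because it also sends the
    default \<open>True\<close> to the default \<open>False\<close>.\<close>
  also have "\<dots> = map_pmf (\<lambda>F. card {v \<in> B. \<not> F v}) (Pi_pmf B True (\<lambda>_. bernoulli_pmf p))"
    using \<open>finite B\<close> by (simp add: Pi_pmf_map[where dflt = True] map_pmf_comp)
  also have "\<dots> = map_pmf (\<lambda>F. card {v \<in> B. \<not> F v}) (Pi_pmf A True (\<lambda>_. bernoulli_pmf p))"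
    using assms by (simp add: Pi_pmf_subset[of A B] map_pmf_comp cong: conj_cong)
  finally show ?thesis by simp
qed

text \<open>On the event, \<open>t\<close> is one live node of \<open>B\<close> and \<open>s\<close>
  lies outside \<open>B\<close>; the other live nodes of \<open>B\<close> form a binomial count with
  \<open>card B - 1\<close> trials, independent of the event.\<close>

lemma nn_integral_inverse_card_live_le:
  fixes s t :: nat and p :: real
  assumes "finite A" "B \<subseteq> A" "s \<in> A" "s \<notin> B" "t \<in> B" and p: "0 \<le> p" "p < 1"
  defines "P \<equiv> Pi_pmf A True (\<lambda>_. bernoulli_pmf p)"
  shows "(\<integral>\<^sup>+ F. ennreal (1 / real (card {v \<in> B. \<not> F v})) * indicator {F. \<not> F s \<and> \<not> F t} F \<partial>P)
    \<le> ennreal (1 / (real (card B) * (1 - p))) * emeasure P {F. \<not> F s \<and> \<not> F t}"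
proof -
  define E where "E = {F. \<not> F s \<and> \<not> F t}"
  define B' where "B' = B - {t}"
  define h where "h F G = ennreal (1 / (1 + real (card {v \<in> B'. \<not> G v}))) * indicator E F"
    for F G :: "nat \<Rightarrow> bool"
  have "finite B" using assms finite_subset by blast
  have card_B: "card B = Suc (card B')"
    unfolding B'_def using \<open>finite B\<close> \<open>t \<in> B\<close> by (rule card.remove)
  have h_diag: "ennreal (1 / real (card {v \<in> B. \<not> F v})) * indicator E F = h F F" for F
  proof (cases "F \<in> E")
    case True
    then have "{v \<in> B. \<not> F v} = insert t {v \<in> B'. \<not> F v}"
      using \<open>t \<in> B\<close> by (auto simp: B'_def E_def)
    then show ?thesis using \<open>finite B\<close> by (simp add: h_def B'_def)
  qed (simp add: h_def)
  have h_cong: "h F G = h F' G'"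
    if "\<And>x. x \<in> {s, t} \<Longrightarrow> F x = F' x" "\<And>x. x \<notin> {s, t} \<Longrightarrow> G x = G' x" for F F' G G'
  proof -
    have "{v \<in> B'. \<not> G v} = {v \<in> B'. \<not> G' v}"
      using that(2) \<open>s \<notin> B\<close> by (intro Collect_cong) (metis B'_def DiffE insertE singletonD)
    moreover have "F \<in> E \<longleftrightarrow> F' \<in> E" using that(1) by (simp add: E_def)
    ultimately show ?thesis by (simp add: h_def indicator_def)
  qed
  have "(\<integral>\<^sup>+ F. ennreal (1 / real (card {v \<in> B. \<not> F v})) * indicator E F \<partial>P)
      = (\<integral>\<^sup>+ F. \<integral>\<^sup>+ G. h F G \<partial>P \<partial>P)"
    unfolding h_diag P_def
    by (rule nn_integral_Pi_pmf_indep[where A = "{s, t}", OF _ _ h_cong]) (use assms in auto)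
  also have "\<dots> = (\<integral>\<^sup>+ G. ennreal (1 / (1 + real (card {v \<in> B'. \<not> G v}))) \<partial>P) * emeasure P E"
    by (simp add: h_def nn_integral_multc nn_integral_cmult)
  also have "(\<integral>\<^sup>+ G. ennreal (1 / (1 + real (card {v \<in> B'. \<not> G v}))) \<partial>P)
      = (\<integral>\<^sup>+ k. ennreal (1 / (1 + real k)) \<partial>map_pmf (\<lambda>G. card {v \<in> B'. \<not> G v}) P)"
    by simp
  also have "\<dots> = (\<integral>\<^sup>+ k. ennreal (1 / (1 + real k)) \<partial>binomial_pmf (card B') (1 - p))"
    unfolding P_def using assms by (subst map_pmf_card_live) (auto simp: B'_def)
  also have "\<dots> * emeasure P E \<le> ennreal (1 / (real (card B) * (1 - p))) * emeasure P E"
    using nn_integral_binomial_pmf_inverse_Suc_le[of "1 - p" "card B'"] p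
    by (intro mult_right_mono) (simp_all add: card_B)
  finally show ?thesis by (simp add: E_def)
qed

text \<open>The \<open>2 ^ j\<close> nodes starting at \<open>t\<close> and heading towards
  \<open>s\<close> stop before \<open>s\<close>, so all of them lie in
  \<open>{1..n}\<close>.\<close>

lemma card_phase_ball_ge:
  assumes "s \<in> {1..n}" "t \<in> {1..n}" "2 ^ j \<le> node_dist s t"
  shows "2 ^ j \<le> card (phase_ball n t j)"
proof -
  have j: "2 ^ j \<le> s - t + (t - s)"
    using assms(3) unfolding node_dist_nat by (metis of_nat_le_iff of_nat_numeral of_nat_power)
  have ball: "v \<in> phase_ball n t j" if "v \<in> {1..n}" "v - t + (t - v) < 2 ^ j" for v
    using that unfolding phase_ball_def node_dist_nat
    by (metis (mono_tags, lifting) mem_Collect_eq of_nat_less_iff of_nat_numeral of_nat_power)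
  show ?thesis
  proof (cases "t \<le> s")
    case True
    have "{t..<t + 2 ^ j} \<subseteq> phase_ball n t j"
      by (rule subsetI, rule ball) (use True j assms in auto)
    then have "card {t..<t + 2 ^ j} \<le> card (phase_ball n t j)"
      by (rule card_mono[OF finite_phase_ball])
    then show ?thesis by simp
  next
    case False
    have "{t - 2 ^ j<..t} \<subseteq> phase_ball n t j"
      by (rule subsetI, rule ball) (use False j assms in auto)
    then have "card {t - 2 ^ j<..t} \<le> card (phase_ball n t j)"
      by (rule card_mono[OF finite_phase_ball])
    then show ?thesis using False j by simp
  qed
qed

text \<open>Expectation passes through the sum over phases, and in each phase the factor
  \<open>2 ^ j\<close> cancels against the size of the ball, which leaves a bound independent of
  \<open>j\<close>.\<close>

lemma nn_integral_potential_live_le: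
  assumes "s \<in> {1..n}" "t \<in> {1..n}" and p: "0 \<le> p" "p < 1" and "0 \<le> H"
  defines "P \<equiv> Pi_pmf {1..n} True (\<lambda>_. bernoulli_pmf p)"
  shows "(\<integral>\<^sup>+ F. ennreal (potential n t H F (node_dist s t)) * indicator {F. \<not> F s \<and> \<not> F t} F \<partial>P)
    \<le> ennreal (real (card {j::nat. 2 ^ j \<le> node_dist s t}) * (3 * H / (1 - p)))
      * emeasure P {F. \<not> F s \<and> \<not> F t}"
proof -
  define E where "E = {F. \<not> F s \<and> \<not> F t}"
  define J where "J = {j::nat. 2 ^ j \<le> node_dist s t}"
  have phase: "(\<integral>\<^sup>+ F. ennreal (phase_cost n t H F j) * indicator E F \<partial>P)
      \<le> ennreal (3 * H / (1 - p)) * emeasure P E" if "j \<in> J" for j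
  proof -
    define B where "B = phase_ball n t j"
    have j: "2 ^ j \<le> node_dist s t" using that by (simp add: J_def)
    have "2 ^ j \<le> card B"
      unfolding B_def by (rule card_phase_ball_ge[OF assms(1,2) j])
    then have card_B: "2 ^ j \<le> real (card B)"
      by (metis of_nat_le_iff of_nat_numeral of_nat_power)
    then have "0 < real (card B)" by (rule less_le_trans[rotated]) simp
    have "(\<integral>\<^sup>+ F. ennreal (phase_cost n t H F j) * indicator E F \<partial>P)
        = (\<integral>\<^sup>+ F. ennreal (3 * 2 ^ j * H) * (ennreal (1 / real (card {v \<in> B. \<not> F v})) * indicator E F) \<partial>P)"
      using \<open>0 \<le> H\<close> by (simp add: phase_cost_def B_def mult.assoc[symmetric] flip: ennreal_mult)
    also have "\<dots> = ennreal (3 * 2 ^ j * H)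
        * (\<integral>\<^sup>+ F. ennreal (1 / real (card {v \<in> B. \<not> F v})) * indicator E F \<partial>P)"
      by (rule nn_integral_cmult) simp
    \<comment> \<open>Since \<open>2 ^ j \<le> node_dist s t\<close>, the source lies outside the
      ball, while \<open>t\<close> is its centre.\<close>
    also have "\<dots> \<le> ennreal (3 * 2 ^ j * H) * (ennreal (1 / (real (card B) * (1 - p))) * emeasure P E)"
      unfolding E_def P_def using assms j
      by (intro mult_left_mono nn_integral_inverse_card_live_le)
         (auto simp: B_def phase_ball_def node_dist_def)
    also have "\<dots> = ennreal (3 * 2 ^ j * H * (1 / (real (card B) * (1 - p)))) * emeasure P E"
      using \<open>0 \<le> H\<close> p by (simp only: mult.assoc[symmetric]) (subst ennreal_mult, auto)
    also have "\<dots> \<le> ennreal (3 * H / (1 - p)) * emeasure P E"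
    proof (intro mult_right_mono ennreal_leI)
      have "3 * 2 ^ j * H * (1 / (real (card B) * (1 - p))) = 3 * H / (1 - p) * (2 ^ j / real (card B))"
        by (simp add: mult_ac)
      also have "\<dots> \<le> 3 * H / (1 - p) * 1"
        using card_B \<open>0 < real (card B)\<close> \<open>0 \<le> H\<close> p by (intro mult_left_mono) auto
      finally show "3 * 2 ^ j * H * (1 / (real (card B) * (1 - p))) \<le> 3 * H / (1 - p)" by simp
    qed simp
    finally show ?thesis .
  qed
  have "(\<integral>\<^sup>+ F. ennreal (potential n t H F (node_dist s t)) * indicator E F \<partial>P)
      = (\<integral>\<^sup>+ F. (\<Sum>j\<in>J. ennreal (phase_cost n t H F j) * indicator E F) \<partial>P)"
    using \<open>0 \<le> H\<close>
    by (simp add: potential_def J_def phase_cost_nonneg flip: sum_distrib_right sum_ennreal)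
  also have "\<dots> = (\<Sum>j\<in>J. \<integral>\<^sup>+ F. ennreal (phase_cost n t H F j) * indicator E F \<partial>P)"
    by (rule nn_integral_sum) simp
  also have "\<dots> \<le> (\<Sum>j\<in>J. ennreal (3 * H / (1 - p)) * emeasure P E)"
    by (intro sum_mono phase)
  also have "\<dots> = ennreal (real (card J) * (3 * H / (1 - p))) * emeasure P E"
    using \<open>0 \<le> H\<close> p
    by (subst ennreal_mult) (auto simp: ennreal_of_nat_eq_real_of_nat mult.assoc)
  finally show ?thesis by (simp add: E_def J_def)
qed

section \<open>Conditioning on live endpoints and the final bound\<close>

text \<open>The conditional expectation is the integral over the event divided by its probability.
  The event concerns failures only, so the bound for fixed failures applies inside it, and the
  probability cancels.\<close>

lemma expected_delivery_time_le:
  assumes pick: "\<And>u A. A \<noteq> {} \<Longrightarrow> pick u A \<in> A" and "n \<ge> 2" "l \<ge> 1"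
    and s: "s \<in> {1..n}" and t: "t \<in> {1..n}" and p: "0 \<le> p" "p < 1"
    and H: "\<And>u. u \<in> {1..n} \<Longrightarrow> (\<Sum>v\<in>{1..n} - {u}. 1 / node_dist u v) \<le> H" "0 \<le> H"
  shows "expected_delivery_time n l p pick s t
    \<le> ennreal (real (card {j::nat. 2 ^ j \<le> node_dist s t}) * (3 * H / (1 - p)))"
proof -
  define P where "P = Pi_pmf {1..n} True (\<lambda>_. bernoulli_pmf p)"
  define E where "E = {F. \<not> F s \<and> \<not> F t}"
  define A where "A = {\<omega>::network. {s, t} \<subseteq> live n \<omega>}"
  define K where "K = ennreal (real (card {j::nat. 2 ^ j \<le> node_dist s t}) * (3 * H / (1 - p)))"
  define D where "D \<omega> = ennreal_of_enat (delivery_time n l pick \<omega> s t)" for \<omega>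
  have A: "A = snd -` E" using s t by (auto simp: A_def E_def live_def)
  have possible: "set_pmf (network_pmf n l p) \<inter> A \<noteq> {}"
    unfolding A_def by (rule conditioning_event_possible[OF p s t])
  have net: "network_pmf n l p = pair_pmf (links_pmf n l) P"
    by (simp add: network_pmf_def links_pmf_def P_def)
  have "emeasure (network_pmf n l p) A = emeasure (map_pmf snd (network_pmf n l p)) E"
    by (simp add: A)
  then have emeasure_A: "emeasure (network_pmf n l p) A = emeasure P E"
    by (simp add: net map_snd_pair_pmf)
  have "emeasure P E \<noteq> 0"
    using possible emeasure_measure_pmf_not_zero emeasure_A by metis
  \<comment> \<open>The pair is swapped so that failures are integrated outermost, with the links
    averaged for each fixed \<open>F\<close>.\<close>
  have "(\<integral>\<^sup>+ \<omega>. D \<omega> * indicator A \<omega> \<partial>network_pmf n l p)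
      = (\<integral>\<^sup>+ F. \<integral>\<^sup>+ f. D (f, F) * indicator E F \<partial>links_pmf n l \<partial>P)"
    unfolding net by (subst pair_commute_pmf) (simp add: nn_integral_pair_pmf' A indicator_vimage)
  also have "\<dots> = (\<integral>\<^sup>+ F. (\<integral>\<^sup>+ f. D (f, F) \<partial>links_pmf n l) * indicator E F \<partial>P)"
    by (simp add: nn_integral_multc)
  also have "\<dots> \<le> (\<integral>\<^sup>+ F. ennreal (potential n t H F (node_dist s t)) * indicator E F \<partial>P)"
  proof (rule nn_integral_mono)
    fix F
    show "(\<integral>\<^sup>+ f. D (f, F) \<partial>links_pmf n l) * indicator E F
        \<le> ennreal (potential n t H F (node_dist s t)) * indicator E F"
    proof (cases "F \<in> E")
      case True
      then have "\<not> F t" by (simp add: E_def)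
      then show ?thesis
        unfolding D_def using assms True
        by (intro mult_right_mono nn_integral_delivery_time_le_potential) auto
    qed simp
  qed
  also have "\<dots> \<le> K * emeasure P E"
    unfolding K_def E_def P_def by (rule nn_integral_potential_live_le[OF s t p H(2)])
  finally have "(\<integral>\<^sup>+ \<omega>. D \<omega> * indicator A \<omega> \<partial>network_pmf n l p) / emeasure P E
      \<le> K * emeasure P E / emeasure P E"
    by (rule divide_right_mono_ennreal)
  also have "\<dots> = K"
    using \<open>emeasure P E \<noteq> 0\<close> by (simp add: ennreal_mult_divide_eq)
  finally show ?thesis
    unfolding expected_delivery_time_def A_def[symmetric] D_def[symmetric] K_def[symmetric]
    by (simp add: cond_pmf.rep_eq[OF possible] nn_integral_uniform_measure emeasure_A)
qed

text \<open>A phase satisfies \<open>2 ^ j \<le> n\<close>, so \<open>j \<le> log 2 n\<close>; the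
  extra 1 counts phase 0.\<close>

lemma card_phases_le:
  assumes "s \<in> {1..n}" "t \<in> {1..n}"
  shows "real (card {j::nat. 2 ^ j \<le> node_dist s t}) \<le> log 2 (real n) + 1"
proof -
  have "1 \<le> n" using assms by simp
  have "{j::nat. 2 ^ j \<le> node_dist s t} \<subseteq> {..nat \<lfloor>log 2 (real n)\<rfloor>}"
  proof safe
    fix j :: nat assume "2 ^ j \<le> node_dist s t"
    also have "node_dist s t \<le> real n" using assms by (auto simp: node_dist_def)
    finally have "real j \<le> log 2 (real n)"
      using \<open>1 \<le> n\<close> by (simp add: le_log_iff powr_realpow)
    then show "j \<le> nat \<lfloor>log 2 (real n)\<rfloor>" by linarith
  qed
  then have "card {j::nat. 2 ^ j \<le> node_dist s t} \<le> Suc (nat \<lfloor>log 2 (real n)\<rfloor>)"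
    by (metis card_atMost card_mono finite_atMost)
  moreover have "0 \<le> log 2 (real n)" using \<open>1 \<le> n\<close> by simp
  ultimately show ?thesis by linarith
qed

theorem theorem10:
  shows "\<exists>C::real. C > 0 \<and>
    (\<forall>(n::nat) (l::nat) (p::real) (s::nat) (t::nat) (pick :: nat \<Rightarrow> nat set \<Rightarrow> nat).
       1 \<le> l \<and> real l \<le> log 2 (real n) \<and> 0 \<le> p \<and> p < 1 \<and>
       s \<in> {1..n} \<and> t \<in> {1..n} \<and> (\<forall>u A. A \<noteq> {} \<longrightarrow> pick u A \<in> A) \<longrightarrow>
       expected_delivery_time n l p pick s t \<le> ennreal (C * ((log 2 (real n))\<^sup>2 / (1 - p))))"
proof (intro exI[of _ 24] conjI allI impI)
  fix n l :: nat and p :: real and s t :: nat and pick :: "nat \<Rightarrow> nat set \<Rightarrow> nat"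
  assume asm: "1 \<le> l \<and> real l \<le> log 2 (real n) \<and> 0 \<le> p \<and> p < 1 \<and>
    s \<in> {1..n} \<and> t \<in> {1..n} \<and> (\<forall>u A. A \<noteq> {} \<longrightarrow> pick u A \<in> A)"
  define L where "L = log 2 (real n)"
  define H where "H = 2 * (1 + ln (real n))"
  define c where "c = real (card {j::nat. 2 ^ j \<le> node_dist s t})"
  have "0 < n" using asm by auto
  from asm have "1 \<le> l" "real l \<le> L" by (auto simp: L_def)
  \<comment> \<open>This gives \<open>n \<ge> 2\<close> and lets additive constants be absorbed into
    multiples of \<open>L\<close>.\<close>
  then have L: "1 \<le> L" by linarith
  then have "2 \<le> n" using \<open>0 < n\<close> by (simp add: L_def le_log_iff)
  have "ln (real n) = L * ln 2" by (simp add: L_def log_def)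
  also have "\<dots> \<le> L * 1"
    using L ln_le_minus_one[of "2::real"] by (intro mult_left_mono) auto
  finally have H: "H \<le> 4 * L" using L by (simp add: H_def)
  have "0 \<le> H" using \<open>2 \<le> n\<close> by (simp add: H_def)
  have c: "0 \<le> c" "c \<le> 2 * L"
    using card_phases_le[of s n t] asm L by (simp_all add: c_def L_def)
  have "expected_delivery_time n l p pick s t \<le> ennreal (c * (3 * H / (1 - p)))"
    unfolding c_def
  proof (rule expected_delivery_time_le)
    show "(\<Sum>v\<in>{1..n} - {u}. 1 / node_dist u v) \<le> H" if "u \<in> {1..n}" for u
      unfolding H_def by (rule sum_inverse_node_dist_le[OF that])
  qed (use asm \<open>2 \<le> n\<close> \<open>0 \<le> H\<close> in auto)
  \<comment> \<open>The witness 24 is \<open>2 * 3 * 4\<close>: at most \<open>2 * L\<close> phases,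
    the 3 of the phase cost, and \<open>H \<le> 4 * L\<close>.\<close>
  also have "c * (3 * H / (1 - p)) \<le> 2 * L * (3 * (4 * L) / (1 - p))"
    using asm c H \<open>0 \<le> H\<close> L by (intro mult_mono divide_right_mono) auto
  also have "\<dots> = 24 * (L\<^sup>2 / (1 - p))"
    by (simp add: power2_eq_square)
  finally show "expected_delivery_time n l p pick s t \<le> ennreal (24 * ((log 2 (real n))\<^sup>2 / (1 - p)))"
    by (simp add: L_def ennreal_leI)
qed simp

end
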